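(* Let $G=(V,E)$ be a finite undirected graph with edge weights $w_e\ge 0$, $e\in E$. Assume that $G$ has a unique maximum-weight matching $M^*$ and that the LP relaxation of the maximum-weight matching problem has a unique optimal solution. Assume moreover that the LP relaxation is tight. Let $z=(z_i)_{i\in V}$ be an optimal solution of the dual linear program and let $\epsilon>0$ be such that $$w_{ij}\le z_i+z_j-\epsilon\qquad\text{for all }(i,j)\in E\setminus M^*.$$ Let $w_{max}=\max_{e\in E}w_e$. Then max-product converges to the correct answer by step $\frac{2w_{max}}{\epsilon}$. That is, for every edge $e\in E$ and every time $t$ at which the computation tree $T_e(t)$ is full up to depth $\frac{2w_{max}}{\epsilon}$ (under synchronous or asynchronous message updates), the max-product beliefs satisfy $b_e^t[1]>b_e^t[0]$ if $e\in M^*$, and $b_e^t[1]<b_e^t[0]$ if $e\notin M^*$.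
   Context: **Matching and LP.** A matching is a set of edges no two of which share a node; its weight is the sum of the weights of its edges. $\mathcal{N}(i)$ is the set of neighbors of $i$ in $G$. The maximum-weight matching integer program is: maximize $\sum_{e\in E} w_ex_e$ subject to $\sum_{j\in\mathcal{N}(i)}x_{ij}\le 1$ for all $i\in V$ and $x_e\in\{0,1\}$ for all $e\in E$. The LP relaxation replaces $x_e\in\{0,1\}$ by $x_e\ge 0$. The LP relaxation is *tight* if it has a unique optimal solution and at this solution all values $x_e$ are $0$ or $1$. The dual linear program is: minimize $\sum_{i\in V} z_i$ subject to $w_{ij}\le z_i+z_j$ for all $(i,j)\in E$ and $z_i\ge 0$ for all $i\in V$. **Max-product.** Max-product is run on the distribution $$p(x)=\frac1Z\prod_{i\in V}\mathbf 1_{\{\sum_{j\in\mathcal{N}(i)}x_{ij}\le 1\}}\prod_{e\in E}e^{w_ex_e},\qquad x\in\{0,1\}^E,$$ with edges as variables and nodes as factors. Messages are vectors indexed by $\{0,1\}$, all initialized to $1$, with updates $$m_{(i,j)\to i}^{t+1}[1]=e^{w_{ij}}m^t_{j\to(i,j)}[1],\qquad m_{(i,j)\to i}^{t+1}[0]=m^t_{j\to(i,j)}[0],$$ $$m_{i\to(i,j)}^{t+1}[1]=\prod_{k\in\mathcal{N}(i)-j}m^t_{(k,i)\to i}[0],$$ $$m_{i\to(i,j)}^{t+1}[0]=\max\Big\{\prod_{k\in\mathcal{N}(i)-j}m^t_{(k,i)\to i}[0],\ \max_{k\in\mathcal{N}(i)-j}m^t_{(k,i)\to i}[1]\Big\}$$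 (messages considered up to the usual normalization; the second entry of the last maximum is understood as the best weight obtained by selecting exactly one of the edges $(k,i)$, $k\in\mathcal N(i)-j$). Beliefs are $$b_{(i,j)}^t[0]=m^t_{i\to(i,j)}[0]\,m^t_{j\to(i,j)}[0],\qquad b_{(i,j)}^t[1]=e^{w_{ij}}m^t_{i\to(i,j)}[1]\,m^t_{j\to(i,j)}[1].$$ Updates may be synchronous (all messages updated at every step) or asynchronous (only a subset updated at each step). **Computation tree.** The full depth-$k$ computation tree $\overline{T}_e(k)$ rooted at edge $e$ is defined recursively: $\overline{T}_e(1)$ is the single edge $e$ (the root), both of whose endpoints are leaves; $\overline{T}_e(k)$ is obtained from $\overline{T}_e(k-1)$ by adding to each leaf $v$, as children, a copy of each neighbor in $G$ of (the node copied by) $v$, except for the unique neighbor of $v$ already present in $\overline{T}_e(k-1)$. Each new edge has the weight of the edge of $G$ it copies. For synchronous updates the computation tree at time $k$ is $T_e(k)=\overline{T}_e(k)$; for asynchronous updates $T_e(k)$ is a subtree of $\overline{T}_e(k)$ containing the root. $T_e(t)$ is *full up to depth $k_1$* if it contains $\overline{T}_e(k_1)$ (for non-integer $k_1$: if it contains $\overline T_e(k)$ for some integer $k\ge k_1$). **Beliefs via the computation tree.** The max-product belief of $e$ at time $t$ is the root belief on $T_e(t)$: $b_e^t[1]>b_e^t[0]$ (respectively $<$) holds if and only if the maximum weight of a matching on $T_e(t)$ containing the root edge is strictly larger (respectively smaller) than the maximum weight of a matching on $T_e(t)$ not containing the root edge. This characterization may be taken as the definition of the beliefs.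
   Formalization: The computation tree is required to be full up to an integer depth strictly greater than 2w_max/ε; at depth exactly 2w_max/ε the two beliefs can tie (path with weights 1, 1/2, 1, 1/2, 1, ε=1, middle edge), so the claim as stated fails there. *)

theory Defs
  imports Complex_Main "HOL-Library.FuncSet"
begin

section \<open>Graphs and matchings\<close>

text \<open>
  Edges are two-element vertex sets, so graphs have neither loops nor parallel edges, and the
  weight $w_{ij}$ is \<open>w {i, j}\<close>.
\<close>

definition simple_graph :: "'v set \<Rightarrow> 'v set set \<Rightarrow> bool" where
  "simple_graph V E \<longleftrightarrow> finite V \<and> (\<forall>e\<in>E. e \<subseteq> V \<and> card e = 2)"

definition neighbors :: "'v set set \<Rightarrow> 'v \<Rightarrow> 'v set" where
  "neighbors E i = {j. {i, j} \<in> E}"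

definition is_matching :: "'v set set \<Rightarrow> 'v set set \<Rightarrow> bool" where
  "is_matching E M \<longleftrightarrow> M \<subseteq> E \<and> (\<forall>e\<in>M. \<forall>f\<in>M. e \<noteq> f \<longrightarrow> e \<inter> f = {})"

definition max_weight_matching :: "'v set set \<Rightarrow> ('v set \<Rightarrow> real) \<Rightarrow> 'v set set \<Rightarrow> bool" where
  "max_weight_matching E w M \<longleftrightarrow>
     is_matching E M \<and> (\<forall>N. is_matching E N \<longrightarrow> sum w N \<le> sum w M)"

definition w_max :: "'v set set \<Rightarrow> ('v set \<Rightarrow> real) \<Rightarrow> real" where
  "w_max E w = Max (w ` E)"


section \<open>The LP relaxation and its dual\<close>

text \<open>
  A point of $\mathbb{R}_{\geq 0}^E$ is a function that is \<open>undefined\<close> outside \<open>E\<close>, so that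
  uniqueness of an optimal solution is equality of functions.
\<close>

definition lp_feasible :: "'v set \<Rightarrow> 'v set set \<Rightarrow> ('v set \<Rightarrow> real) \<Rightarrow> bool" where
  "lp_feasible V E x \<longleftrightarrow>
     x \<in> E \<rightarrow>\<^sub>E {0..} \<and> (\<forall>i\<in>V. (\<Sum>j\<in>neighbors E i. x {i, j}) \<le> 1)"

definition lp_optimal :: "'v set \<Rightarrow> 'v set set \<Rightarrow> ('v set \<Rightarrow> real) \<Rightarrow> ('v set \<Rightarrow> real) \<Rightarrow> bool" where
  "lp_optimal V E w x \<longleftrightarrow>
     lp_feasible V E x \<and>
     (\<forall>y. lp_feasible V E y \<longrightarrow> (\<Sum>e\<in>E. w e * y e) \<le> (\<Sum>e\<in>E. w e * x e))"

definition lp_tight :: "'v set \<Rightarrow> 'v set set \<Rightarrow> ('v set \<Rightarrow> real) \<Rightarrow> bool" where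
  "lp_tight V E w \<longleftrightarrow>
     (\<exists>x. lp_optimal V E w x \<and> (\<forall>y. lp_optimal V E w y \<longrightarrow> y = x) \<and> (\<forall>e\<in>E. x e \<in> {0, 1}))"

definition dual_feasible :: "'v set \<Rightarrow> 'v set set \<Rightarrow> ('v set \<Rightarrow> real) \<Rightarrow> ('v \<Rightarrow> real) \<Rightarrow> bool" where
  "dual_feasible V E w z \<longleftrightarrow>
     (\<forall>i j. {i, j} \<in> E \<longrightarrow> w {i, j} \<le> z i + z j) \<and> (\<forall>i\<in>V. 0 \<le> z i)"

definition dual_optimal :: "'v set \<Rightarrow> 'v set set \<Rightarrow> ('v set \<Rightarrow> real) \<Rightarrow> ('v \<Rightarrow> real) \<Rightarrow> bool" where
  "dual_optimal V E w z \<longleftrightarrow>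
     dual_feasible V E w z \<and> (\<forall>y. dual_feasible V E w y \<longrightarrow> sum z V \<le> sum y V)"


section \<open>Computation trees\<close>

text \<open>
  A node of a computation tree rooted at the edge \<open>e\<close> is a nonempty list of vertices of the
  graph. The endpoints of the root edge are the lists \<open>[u]\<close> with \<open>u \<in> e\<close>, and a child of the
  node \<open>p\<close> is \<open>x # p\<close>. The node \<open>p\<close> is a copy of the vertex \<open>hd p\<close>; consequently
  the tree edge \<open>d\<close> is a copy of the edge \<open>hd ` d\<close>.
\<close>

type_synonym 'v ctree = "'v list set \<times> 'v list set set"

abbreviation nodes :: "'v ctree \<Rightarrow> 'v list set" where "nodes T \<equiv> fst T"
abbreviation edges :: "'v ctree \<Rightarrow> 'v list set set" where "edges T \<equiv> snd T"

definition root_edge :: "'v set \<Rightarrow> 'v list set" where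
  "root_edge e = (\<lambda>u. [u]) ` e"

definition leaf :: "'v ctree \<Rightarrow> 'v list \<Rightarrow> bool" where
  "leaf T p \<longleftrightarrow> p \<in> nodes T \<and> card (neighbors (edges T) p) = 1"

definition new_children :: "'v set set \<Rightarrow> 'v ctree \<Rightarrow> 'v list \<Rightarrow> 'v list set" where
  "new_children E T p =
     {x # p | x. x \<in> neighbors E (hd p) \<and> (\<forall>q\<in>neighbors (edges T) p. x \<noteq> hd q)}"

definition grow :: "'v set set \<Rightarrow> 'v ctree \<Rightarrow> 'v ctree" where
  "grow E T =
     (nodes T \<union> {c. \<exists>p. leaf T p \<and> c \<in> new_children E T p},
      edges T \<union> {{p, c} | p c. leaf T p \<and> c \<in> new_children E T p})"

text \<open>The depth is at least 1; the value at \<open>k = 0\<close> is irrelevant.\<close>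

definition full_tree :: "'v set set \<Rightarrow> 'v set \<Rightarrow> nat \<Rightarrow> 'v ctree" where
  "full_tree E e k = (grow E ^^ (k - 1)) (root_edge e, {root_edge e})"

definition contained :: "'v ctree \<Rightarrow> 'v ctree \<Rightarrow> bool" where
  "contained S T \<longleftrightarrow> nodes S \<subseteq> nodes T \<and> edges S \<subseteq> edges T"

definition rooted_subtree :: "'v set \<Rightarrow> 'v ctree \<Rightarrow> 'v ctree \<Rightarrow> bool" where
  "rooted_subtree e S T \<longleftrightarrow>
     contained S T \<and> root_edge e \<in> edges S \<and> \<Union> (edges S) \<subseteq> nodes S \<and>
     (\<forall>p\<in>nodes S. \<forall>q\<in>nodes S. (p, q) \<in> {(a, b). {a, b} \<in> edges S}\<^sup>*)"

text \<open>
  \<open>T e t\<close> is the computation tree of the edge \<open>e\<close> at time \<open>t\<close>. Synchronous updates are the case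
  \<open>T = full_tree E\<close>; every other such family comes under asynchronous updates.
\<close>

definition computation_trees :: "'v set set \<Rightarrow> ('v set \<Rightarrow> nat \<Rightarrow> 'v ctree) \<Rightarrow> bool" where
  "computation_trees E T \<longleftrightarrow> (\<forall>e\<in>E. \<forall>t\<ge>1. rooted_subtree e (T e t) (full_tree E e t))"

definition full_up_to_depth :: "'v set set \<Rightarrow> 'v set \<Rightarrow> 'v ctree \<Rightarrow> real \<Rightarrow> bool" where
  "full_up_to_depth E e T d \<longleftrightarrow> (\<exists>k\<ge>1. d \<le> real k \<and> contained (full_tree E e k) T)"

text \<open>
  A remark on the threshold \<open>2 * w_max E w / \<epsilon>\<close>. Correctness with strict inequalities between the
  beliefs requires the tree to be full up to some depth strictly above this number. At the
  threshold itself beliefs can tie: take the path $0-1-2-3-4-5$ with weights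
  $1, \frac12, 1, \frac12, 1$, the dual solution $z = (0, 1, \frac12, \frac12, 1, 0)$ and
  $\epsilon = 1$. The threshold is 2, and the full tree of depth 2 of the edge $\{2,3\}$ is a path
  with weights $\frac12, 1, \frac12$; both beliefs equal \<open>exp 1\<close>, although $\{2,3\}$ is in the
  maximum-weight matching.
\<close>


section \<open>Beliefs\<close>

definition tree_weight :: "('v set \<Rightarrow> real) \<Rightarrow> 'v list set set \<Rightarrow> real" where
  "tree_weight w M = (\<Sum>d\<in>M. w (hd ` d))"

definition max_root_weight :: "('v set \<Rightarrow> real) \<Rightarrow> 'v set \<Rightarrow> 'v ctree \<Rightarrow> nat \<Rightarrow> real" where
  "max_root_weight w e T x =
     Max {tree_weight w M | M. is_matching (edges T) M \<and> of_bool (root_edge e \<in> M) = x}"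

text \<open>
  \<open>belief w e T x\<close> is the entry $b_e[x]$, $x \in \{0,1\}$, of the root belief on the tree \<open>T\<close>, that
  is the max-marginal at the root of the unnormalized distribution on \<open>T\<close>. Only the comparison
  of the two entries matters; it is given by \<open>belief_less_iff\<close>.
\<close>

definition belief :: "('v set \<Rightarrow> real) \<Rightarrow> 'v set \<Rightarrow> 'v ctree \<Rightarrow> nat \<Rightarrow> real" where
  "belief w e T x = exp (max_root_weight w e T x)"

lemma belief_less_iff:
  "belief w e T x < belief w e T y \<longleftrightarrow> max_root_weight w e T x < max_root_weight w e T y"
  by (simp add: belief_def)

end

theory Submission
  imports Defs "HOL-Analysis.Analysis" "HOL-Library.Sublist"
begin

text \<open>
  Tightness makes \<open>M\<close> the optimum of the linear program, so \<open>z\<close> and \<open>M\<close> satisfy complementary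
  slackness. In the computation tree, let \<open>D p\<close> be the difference between the heaviest matching
  below the node \<open>p\<close> and the heaviest one leaving \<open>p\<close> uncovered; it satisfies
  \<open>D p = max 0 (max\<^sub>c (w p c - D c))\<close> over the children \<open>c\<close> of \<open>p\<close>, and the beliefs at the root edge
  \<open>{u, v}\<close> compare \<open>D u + D v\<close> with its weight. On the infinite tree, \<open>z (hd p)\<close> is a solution
  along \<open>M\<close>-alternating paths. At the depth where the tree stops being full the error is at most
  the maximal weight, and each non-matching edge passed on the way back to the root reduces it by
  \<open>\<epsilon>\<close>, that is by \<open>\<epsilon>/2\<close> per level. Once this has exhausted the maximal weight, the comparison at the
  root has the right sign.
\<close>

section \<open>Complementary slackness\<close>

text \<open>Summing over incident edges instead of neighbors makes each vertex constraint a row of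
  the incidence matrix, ready for double counting.\<close>

definition load :: "'v set set \<Rightarrow> ('v set \<Rightarrow> real) \<Rightarrow> 'v \<Rightarrow> real" where
  "load E y i = (\<Sum>e | e \<in> E \<and> i \<in> e. y e)"

lemma simple_graph_finite_edges: "simple_graph V E \<Longrightarrow> finite E"
  unfolding simple_graph_def by (meson Pow_iff finite_Pow_iff rev_finite_subset subsetI)

lemma simple_graph_edgeE:
  assumes "simple_graph V E" "e \<in> E"
  obtains i j where "e = {i, j}" "i \<noteq> j" "i \<in> V" "j \<in> V"
  using assms unfolding simple_graph_def by (metis card_2_iff insert_subset)

lemma simple_graph_no_loop: "simple_graph V E \<Longrightarrow> {i, j} \<in> E \<Longrightarrow> i \<noteq> j"
  unfolding simple_graph_def by fastforce

lemma sum_neighbors_eq_load: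
  assumes "simple_graph V E"
  shows "(\<Sum>j\<in>neighbors E i. y {i, j}) = load E y i"
proof -
  have inj: "inj_on (\<lambda>j. {i, j}) (neighbors E i)"
    by (auto simp: inj_on_def doubleton_eq_iff)
  have "(\<lambda>j. {i, j}) ` neighbors E i = {e \<in> E. i \<in> e}"
  proof (intro equalityI subsetI)
    fix e assume e: "e \<in> {e \<in> E. i \<in> e}"
    then obtain j where "e = {i, j}"
      using simple_graph_edgeE[OF assms, of e] by (metis insertE insert_commute mem_Collect_eq singletonD)
    then show "e \<in> (\<lambda>j. {i, j}) ` neighbors E i" using e by (auto simp: neighbors_def)
  qed (auto simp: neighbors_def)
  then show ?thesis
    using sum.reindex[OF inj, of y] by (simp add: load_def)
qed

text \<open>Double counting of incidences. It converts edge sums of vertex values into vertex sums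
  of loads, both for \<open>z\<close> and for the residuals below.\<close>

lemma sum_load:
  assumes "simple_graph V E"
  shows "(\<Sum>i\<in>V. a i * load E y i) = (\<Sum>e\<in>E. y e * sum a e)"
proof -
  have fV: "finite V" using assms by (simp add: simple_graph_def)
  have "(\<Sum>i\<in>V. a i * load E y i) = (\<Sum>i\<in>V. \<Sum>e | e \<in> E \<and> i \<in> e. a i * y e)"
    by (simp add: load_def sum_distrib_left)
  also have "\<dots> = (\<Sum>e\<in>E. \<Sum>i | i \<in> V \<and> i \<in> e. a i * y e)"
    by (rule sum.swap_restrict[OF fV simple_graph_finite_edges[OF assms]])
  also have "\<dots> = (\<Sum>e\<in>E. y e * sum a e)"
  proof (rule sum.cong[OF refl])
    fix e assume "e \<in> E"
    then have "{i. i \<in> V \<and> i \<in> e} = e" using assms by (auto simp: simple_graph_def)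
    then show "(\<Sum>i | i \<in> V \<and> i \<in> e. a i * y e) = y e * sum a e"
      by (simp add: sum_distrib_left mult.commute)
  qed
  finally show ?thesis .
qed

lemma dual_feasible_iff:
  assumes "simple_graph V E"
  shows "dual_feasible V E w z \<longleftrightarrow> (\<forall>e\<in>E. w e \<le> sum z e) \<and> (\<forall>i\<in>V. 0 \<le> z i)"
proof -
  have "(\<forall>i j. {i, j} \<in> E \<longrightarrow> w {i, j} \<le> z i + z j) \<longleftrightarrow> (\<forall>e\<in>E. w e \<le> sum z e)"
    using simple_graph_edgeE[OF assms] simple_graph_no_loop[OF assms]
    by (smt (verit) finite.emptyI finite.insertI insert_absorb insert_not_empty singletonD
        singleton_insert_inj_eq' sum.empty sum.insert)
  then show ?thesis by (simp add: dual_feasible_def)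
qed

section \<open>Analytic tools for the least-squares argument\<close>

lemma ex_pos_scaling:
  fixes f g :: "'a \<Rightarrow> real"
  assumes "finite A" "\<And>a. a \<in> A \<Longrightarrow> 0 < g a"
  shows "\<exists>\<delta>>0. \<forall>a\<in>A. \<delta> * f a \<le> g a"
  using assms
proof (induction A rule: finite_induct)
  case empty
  then show ?case by (auto intro: exI[of _ 1])
next
  case (insert b A)
  then obtain \<delta> where \<delta>: "0 < \<delta>" "\<forall>a\<in>A. \<delta> * f a \<le> g a" by auto
  have gb: "0 < g b" using insert.prems by simp
  \<comment> \<open>The summand \<open>1\<close> keeps the denominator positive when
    \<open>f b = 0\<close>.\<close>
  define \<eta> where "\<eta> = min \<delta> (g b / (1 + \<bar>f b\<bar>))"
  have \<eta>: "0 < \<eta>" "\<eta> \<le> \<delta>" using \<delta> gb by (auto simp: \<eta>_def)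
  have "\<eta> * f b \<le> \<eta> * (1 + \<bar>f b\<bar>)" using \<eta> by (intro mult_left_mono) auto
  also have "\<dots> \<le> g b / (1 + \<bar>f b\<bar>) * (1 + \<bar>f b\<bar>)"
    by (intro mult_right_mono) (auto simp: \<eta>_def)
  also have "\<dots> = g b" by (smt (verit) abs_ge_zero nonzero_divide_eq_eq)
  finally have b: "\<eta> * f b \<le> g b" .
  have "\<eta> * f a \<le> g a" if "a \<in> A" for a
  proof (cases "f a \<le> 0")
    case True
    then show ?thesis using \<eta> insert.prems[of a] that
      by (smt (verit) insertCI mult_nonneg_nonpos)
  next
    case False
    then show ?thesis using \<eta> \<delta> that by (smt (verit) mult_right_mono)
  qed
  then show ?case using b \<eta> by auto
qed

text \<open>The absolute value of \<open>r x\<close> is the distance from \<open>1 - x\<close> to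
  the point 0 or to the half-line of nonnegative reals. The nearest point for \<open>1 - x\<close>
  is still a candidate after the shift by \<open>s\<close>, whence the bound
  \<open>(r x - s)\<^sup>2\<close>.\<close>

lemma sq_shift_le:
  fixes x s :: real
  assumes "\<And>x. r x = (if b then 1 - x else min 0 (1 - x))"
  shows "(r (x + s))\<^sup>2 \<le> (r x)\<^sup>2 - 2 * s * r x + s\<^sup>2"
proof (cases b)
  case True
  then show ?thesis by (simp add: assms power2_eq_square algebra_simps)
next
  case False
  define u where "u = 1 - x"
  have "(min 0 (u - s))\<^sup>2 \<le> (min 0 u - s)\<^sup>2"
  proof (cases "u - s \<ge> 0")
    case True
    then show ?thesis by simp
  next
    case neg: False
    show ?thesis
      using neg by (simp add: abs_le_square_iff[symmetric] min_def)
  qed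
  then show ?thesis using False
    by (simp add: assms u_def power2_eq_square algebra_simps)
qed

text \<open>Tychonoff's theorem, since the index type may be infinite.\<close>

lemma compact_fun_box:
  fixes B :: "'a \<Rightarrow> real set"
  assumes "\<And>i. compact (B i)"
  shows "compact (PiE UNIV B)"
proof -
  have "compactin (product_topology (\<lambda>_. euclidean) UNIV) (PiE UNIV B)"
    using assms by (simp add: compactin_PiE)
  then show ?thesis by (simp add: euclidean_product_topology)
qed

lemma load_fun_upd:
  assumes "finite E" "e \<in> E"
  shows "load E (y(e := y e + s)) i = load E y i + (if i \<in> e then s else 0)"
proof (cases "i \<in> e")
  case True
  have *: "{f. f \<in> E \<and> i \<in> f} = insert e {f \<in> E - {e}. i \<in> f}" using True assms by auto
  show ?thesis unfolding load_def * using assms True by (simp cong: sum.cong_simp)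
next
  case False
  then show ?thesis unfolding load_def by (auto intro!: sum.cong)
qed

text \<open>
  Minimise the squared residual of the primal constraints over weights on the tight edges. The
  residual \<open>r\<close> of a minimiser is nonpositive on tight edges, so \<open>z - \<delta> r\<close> is dual feasible for
  small \<open>\<delta>\<close>; its objective is smaller by \<open>\<delta> \<Sum> r\<^sup>2\<close>, whence \<open>r = 0\<close>.
\<close>

lemma ex_complementary_fractional_matching:
  assumes G: "simple_graph V E" and z: "dual_optimal V E w z"
  obtains y where "\<And>e. 0 \<le> y e" "\<And>e. e \<in> E \<Longrightarrow> 0 < y e \<Longrightarrow> w e = sum z e"
    "\<And>i. i \<in> V \<Longrightarrow> load E y i \<le> 1" "\<And>i. i \<in> V \<Longrightarrow> 0 < z i \<Longrightarrow> load E y i = 1"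
proof -
  have fV: "finite V" using G by (simp add: simple_graph_def)
  have fE: "finite E" using simple_graph_finite_edges[OF G] .
  have zE: "w e \<le> sum z e" if "e \<in> E" for e
    using z that by (auto simp: dual_optimal_def dual_feasible_iff[OF G])
  have z0: "0 \<le> z i" if "i \<in> V" for i
    using z that by (auto simp: dual_optimal_def dual_feasible_iff[OF G])
  have eV: "e \<subseteq> V" "card e = 2" if "e \<in> E" for e using G that by (auto simp: simple_graph_def)
  define H where "H = {e \<in> E. sum z e = w e}"
  define r where "r i x = (if 0 < z i then 1 - x else min 0 (1 - x))" for i and x :: real
  define R where "R y i = r i (load E y i)" for y i
  define F where "F y = (\<Sum>i\<in>V. (R y i)\<^sup>2)" for y
  \<comment> \<open>\<open>K\<close> is too large for a minimiser to reach: a coordinate equal to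
    \<open>K\<close> would force \<open>F\<close> to be at least
    \<open>(1 + card V)\<^sup>2\<close>, while the zero vector costs at most
    \<open>card V\<close>.\<close>
  define K :: real where "K = 2 + real (card V)"
  define B where "B = (\<Pi>\<^sub>E e\<in>UNIV. if e \<in> H then {0..K} else {0})"
  have "compact B" unfolding B_def by (rule compact_fun_box) auto
  moreover have zB: "(\<lambda>_. 0) \<in> B" by (auto simp: B_def K_def)
  moreover have "continuous_on B F"
  proof -
    have "continuous_on UNIV (\<lambda>y. load E y i)" for i
      unfolding load_def by (intro continuous_intros continuous_on_product_coordinates)
    then have "continuous_on UNIV (\<lambda>y. R y i)" for i
      unfolding R_def r_def by (cases "0 < z i") (auto intro!: continuous_intros)
    then have "continuous_on UNIV F" unfolding F_def by (intro continuous_intros)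
    then show ?thesis using continuous_on_subset by blast
  qed
  ultimately obtain y where y: "y \<in> B" and ymin: "\<And>x. x \<in> B \<Longrightarrow> F y \<le> F x"
    using continuous_attains_inf[of B F] by blast
  have y0: "0 \<le> y e" for e
    using y by (auto simp: B_def PiE_iff split: if_splits dest!: spec[of _ e])
  have yH: "y e = 0" if "e \<notin> H" for e
    using y that by (auto simp: B_def PiE_iff split: if_splits dest!: spec[of _ e])
  have yK: "y e \<le> K" if "e \<in> H" for e
    using y that by (auto simp: B_def PiE_iff split: if_splits dest!: spec[of _ e])
  have "F y \<le> F (\<lambda>_. 0)" using ymin zB by blast
  also have "\<dots> \<le> (\<Sum>i\<in>V. 1)" unfolding F_def R_def r_def load_def by (intro sum_mono) auto
  finally have FyV: "F y \<le> real (card V)" by simp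
  have yltK: "y e < K" if e: "e \<in> H" for e
  proof (rule ccontr)
    assume "\<not> y e < K"
    with yK[OF e] have yeK: "y e = K" by simp
    have eE: "e \<in> E" using e by (simp add: H_def)
    obtain i j where ij: "e = {i, j}" "i \<in> V" using simple_graph_edgeE[OF G eE] by metis
    have "K \<le> load E y i"
      unfolding load_def yeK[symmetric] using ij eE fE y0 by (intro member_le_sum) auto
    then have "R y i \<le> 1 - K" by (auto simp: R_def r_def K_def)
    then have "(K - 1)\<^sup>2 \<le> (R y i)\<^sup>2" by (auto simp: abs_le_square_iff[symmetric] K_def)
    also have "\<dots> \<le> F y" unfolding F_def using ij fV by (intro member_le_sum) auto
    finally have "(1 + real (card V))\<^sup>2 \<le> real (card V)" using FyV by (simp add: K_def)
    then show False by (simp add: power2_eq_square algebra_simps) (smt (verit) mult_nonneg_nonneg of_nat_0_le_iff)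
  qed
  \<comment> \<open>A first-order condition without derivatives: shifting \<open>y e\<close> by
    \<open>s\<close> changes \<open>F\<close> by at most this amount, the edge having two
    endpoints.\<close>
  have step: "0 \<le> 2 * s * (s - sum (R y) e)" if e: "e \<in> H" and s: "0 \<le> y e + s" "y e + s \<le> K" for e s
  proof -
    have eE: "e \<in> E" using e by (simp add: H_def)
    define x where "x = y(e := y e + s)"
    have "x \<in> B" using y0 yH yK e s by (auto simp: B_def x_def)
    then have "F y \<le> F x" by (rule ymin)
    also have "\<dots> \<le> (\<Sum>i\<in>V. (R y i)\<^sup>2 + (if i \<in> e then s\<^sup>2 - 2 * s * R y i else 0))"
      unfolding F_def
    proof (rule sum_mono)
      fix i
      show "(R x i)\<^sup>2 \<le> (R y i)\<^sup>2 + (if i \<in> e then s\<^sup>2 - 2 * s * R y i else 0)"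
        using sq_shift_le[of "r i" "0 < z i" "load E y i" s]
        unfolding R_def x_def load_fun_upd[OF fE eE] r_def by auto
    qed
    also have "\<dots> = F y + (\<Sum>i\<in>e. s\<^sup>2 - 2 * s * R y i)"
      unfolding F_def using fV eV[OF eE]
      by (simp add: sum.distrib sum.inter_restrict[symmetric] Int_absorb1 Int_commute)
    also have "\<dots> = F y + 2 * s * (s - sum (R y) e)"
      using eV[OF eE] by (simp add: sum_subtractf sum_distrib_left[symmetric] power2_eq_square algebra_simps)
    finally show ?thesis by simp
  qed
  have RH: "sum (R y) e \<le> 0" if e: "e \<in> H" for e
  proof (rule ccontr)
    assume neg: "\<not> sum (R y) e \<le> 0"
    \<comment> \<open>Every \<open>s\<close> strictly between 0 and \<open>sum (R y) e\<close>
      lowers \<open>F\<close>; half of it is capped by the room left below \<open>K\<close>.\<close>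
    define s where "s = min (sum (R y) e / 2) (K - y e)"
    have "0 < s" "s < sum (R y) e" using neg yltK[OF e] by (auto simp: s_def)
    then have "2 * s * (s - sum (R y) e) < 0" by (simp add: mult_pos_neg)
    moreover have "0 \<le> y e + s" "y e + s \<le> K" using y0[of e] \<open>0 < s\<close> by (auto simp: s_def)
    ultimately show False using step[OF e] by fastforce
  qed
  \<comment> \<open>A positive \<open>y e\<close> can also be decreased, so there the residual sum
    cannot be negative either.\<close>
  have yR: "y e * sum (R y) e = 0" for e
  proof (rule ccontr)
    assume neq: "y e * sum (R y) e \<noteq> 0"
    then have e: "e \<in> H" using yH by auto
    have pos: "0 < y e" "sum (R y) e < 0" using neq y0[of e] RH[OF e] by (auto simp: less_le)
    define s where "s = max (sum (R y) e / 2) (- y e)"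
    have "s < 0" "sum (R y) e < s" using pos by (auto simp: s_def)
    then have "2 * s * (s - sum (R y) e) < 0" by (simp add: mult_neg_pos)
    moreover have "0 \<le> y e + s" "y e + s \<le> K" using yK[OF e] \<open>s < 0\<close> by (auto simp: s_def)
    ultimately show False using step[OF e] by fastforce
  qed
  obtain \<delta>1 where \<delta>1: "0 < \<delta>1" "\<forall>i\<in>{i \<in> V. 0 < z i}. \<delta>1 * R y i \<le> z i"
  proof -
    have "\<exists>\<delta>>0. \<forall>i\<in>{i \<in> V. 0 < z i}. \<delta> * R y i \<le> z i"
      using fV by (intro ex_pos_scaling) auto
    then show ?thesis using that by metis
  qed
  obtain \<delta>2 where \<delta>2: "0 < \<delta>2" "\<forall>e\<in>E - H. \<delta>2 * sum (R y) e \<le> sum z e - w e"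
  proof -
    have "0 < sum z e - w e" if "e \<in> E - H" for e
      using zE[of e] that by (auto simp: H_def)
    then have "\<exists>\<delta>>0. \<forall>e\<in>E - H. \<delta> * sum (R y) e \<le> sum z e - w e"
      using fE by (intro ex_pos_scaling) auto
    then show ?thesis using that by metis
  qed
  define \<delta> where "\<delta> = min \<delta>1 \<delta>2"
  have \<delta>: "0 < \<delta>" "\<delta> \<le> \<delta>1" "\<delta> \<le> \<delta>2" using \<delta>1 \<delta>2 by (auto simp: \<delta>_def)
  have shrink: "\<delta> * a \<le> b" if "0 \<le> b" "\<delta>' * a \<le> b" "\<delta> \<le> \<delta>'" for \<delta>' a b :: real
    using that \<delta>(1) by (smt (verit) mult_nonneg_nonpos mult_right_mono)
  have "dual_feasible V E w (\<lambda>i. z i - \<delta> * R y i)"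
    unfolding dual_feasible_iff[OF G]
  proof (intro conjI ballI)
    fix e assume e: "e \<in> E"
    have "\<delta> * sum (R y) e \<le> sum z e - w e"
    proof (cases "e \<in> H")
      case True
      then show ?thesis using RH[OF True] \<delta>(1) by (simp add: H_def mult_nonneg_nonpos)
    next
      case False
      then show ?thesis using \<delta>2 e \<delta> zE[OF e] by (intro shrink[of _ \<delta>2]) auto
    qed
    then show "w e \<le> (\<Sum>i\<in>e. z i - \<delta> * R y i)"
      by (simp add: sum_subtractf sum_distrib_left)
  next
    fix i assume i: "i \<in> V"
    show "0 \<le> z i - \<delta> * R y i"
    proof (cases "0 < z i")
      case True
      then show ?thesis using \<delta>1 i \<delta> shrink[of "z i" \<delta>1 "R y i"] by auto
    next
      case False
      then have "R y i \<le> 0" "z i = 0" using z0[OF i] by (auto simp: R_def r_def)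
      then show ?thesis using \<delta>(1) by (simp add: mult_nonneg_nonpos)
    qed
  qed
  then have "sum z V \<le> (\<Sum>i\<in>V. z i - \<delta> * R y i)" using z by (simp add: dual_optimal_def)
  then have "\<delta> * sum (R y) V \<le> 0" by (simp add: sum_subtractf sum_distrib_left)
  then have sumR: "sum (R y) V \<le> 0" using \<delta>(1) by (simp add: mult_le_0_iff)
  \<comment> \<open>\<open>R y i\<close> is 0 or \<open>1 - load E y i\<close>. In the sum over
    \<open>V\<close> the last term vanishes by \<open>sum_load\<close> and
    \<open>yR\<close>.\<close>
  have "R y i = (R y i)\<^sup>2 + R y i * load E y i" for i
    by (auto simp: R_def r_def power2_eq_square algebra_simps min_def)
  then have "sum (R y) V = F y + (\<Sum>i\<in>V. R y i * load E y i)"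
    unfolding F_def sum.distrib[symmetric] by (intro sum.cong) auto
  also have "\<dots> = F y" by (simp add: sum_load[OF G] yR)
  finally have "F y \<le> 0" using sumR by simp
  then have "F y = 0" unfolding F_def by (simp add: antisym sum_nonneg)
  then have R0: "R y i = 0" if "i \<in> V" for i
    using that fV by (auto simp: F_def sum_nonneg_eq_0_iff)
  show thesis
  proof (rule that)
    show "0 \<le> y e" for e by (rule y0)
    show "w e = sum z e" if "e \<in> E" "0 < y e" for e
      using yH[of e] that by (cases "e \<in> H") (auto simp: H_def)
    show "load E y i \<le> 1" if "i \<in> V" for i
      using R0[OF that] by (auto simp: R_def r_def min_def split: if_splits)
    show "load E y i = 1" if "i \<in> V" "0 < z i" for i
      using R0[OF that(1)] that by (auto simp: R_def r_def)
  qed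
qed

section \<open>Transfer of complementary slackness to the matching\<close>

lemma lp_feasible_iff:
  assumes "simple_graph V E"
  shows "lp_feasible V E x \<longleftrightarrow> x \<in> E \<rightarrow>\<^sub>E {0..} \<and> (\<forall>i\<in>V. load E x i \<le> 1)"
  by (simp add: lp_feasible_def sum_neighbors_eq_load[OF assms])

lemma lp_feasible_matching:
  assumes G: "simple_graph V E" and N: "is_matching E N"
  shows "lp_feasible V E (restrict (\<lambda>e. of_bool (e \<in> N)) E)"
  unfolding lp_feasible_iff[OF G]
proof (intro conjI ballI)
  have fE: "finite E" by (rule simple_graph_finite_edges[OF G])
  fix i
  have "load E (restrict (\<lambda>e. of_bool (e \<in> N)) E) i = (\<Sum>e | e \<in> E \<and> i \<in> e. of_bool (e \<in> N))"
    unfolding load_def by (auto intro: sum.cong)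
  also have "\<dots> = real (card {e \<in> N. i \<in> e})"
    using fE N by (auto simp: is_matching_def intro!: arg_cong[where f = card])
  also have "\<dots> \<le> 1"
  proof -
    have "card {e \<in> N. i \<in> e} \<le> 1"
      using N unfolding is_matching_def
      by (subst One_nat_def, subst card_le_Suc0_iff_eq) (auto intro: finite_subset[OF _ fE])
    then show ?thesis by simp
  qed
  finally show "load E (restrict (\<lambda>e. of_bool (e \<in> N)) E) i \<le> 1" .
qed auto

lemma sum_restrict_matching:
  assumes "finite E" "N \<subseteq> E"
  shows "(\<Sum>e\<in>E. w e * restrict (\<lambda>e. of_bool (e \<in> N)) E e) = (sum w N :: real)"
proof -
  have "(\<Sum>e\<in>E. w e * restrict (\<lambda>e. of_bool (e \<in> N)) E e) = (\<Sum>e\<in>E. if e \<in> N then w e else 0)"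
    by (rule sum.cong) auto
  also have "\<dots> = sum w N"
    using assms by (simp add: sum.inter_restrict[symmetric] Int_absorb1)
  finally show ?thesis .
qed

text \<open>The complementary fractional matching attains the dual value, so weak duality makes it
  optimal and tightness makes it integral. It is then the indicator of a maximum-weight matching,
  which uniqueness identifies with \<open>M\<close>.\<close>

lemma tight_complementary_slackness:
  assumes G: "simple_graph V E" and M: "\<And>N. max_weight_matching E w N \<Longrightarrow> N = M"
    and tight: "lp_tight V E w" and z: "dual_optimal V E w z"
  shows "\<And>e. e \<in> M \<Longrightarrow> w e = sum z e"
    and "\<And>i. i \<in> V \<Longrightarrow> 0 < z i \<Longrightarrow> \<exists>e\<in>M. i \<in> e"
proof -
  have fE: "finite E" by (rule simple_graph_finite_edges[OF G])
  have zE: "w e \<le> sum z e" if "e \<in> E" for e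
    using z that by (auto simp: dual_optimal_def dual_feasible_iff[OF G])
  have z0: "0 \<le> z i" if "i \<in> V" for i
    using z that by (auto simp: dual_optimal_def dual_feasible_iff[OF G])
  obtain y' where y'0: "\<And>e. 0 \<le> y' e" and y'w: "\<And>e. e \<in> E \<Longrightarrow> 0 < y' e \<Longrightarrow> w e = sum z e"
    and y'le: "\<And>i. i \<in> V \<Longrightarrow> load E y' i \<le> 1"
    and y'eq: "\<And>i. i \<in> V \<Longrightarrow> 0 < z i \<Longrightarrow> load E y' i = 1"
    using ex_complementary_fractional_matching[OF G z] by metis
  \<comment> \<open>LP points are \<open>undefined\<close> outside \<open>E\<close>, so
    \<open>y'\<close> has to be restricted before tightness can apply.\<close>
  define y where "y = restrict y' E"
  have load_y: "load E y i = load E y' i" for i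
    unfolding load_def y_def by (auto intro: sum.cong)
  have feas: "lp_feasible V E y"
    using y'0 y'le by (auto simp: lp_feasible_iff[OF G] load_y) (auto simp: y_def)
  have "(\<Sum>e\<in>E. w e * y e) = (\<Sum>e\<in>E. y e * sum z e)"
  proof (rule sum.cong[OF refl])
    fix e assume "e \<in> E"
    then show "w e * y e = y e * sum z e" using y'w[of e] y'0[of e] by (auto simp: y_def less_le)
  qed
  also have "\<dots> = (\<Sum>i\<in>V. z i * load E y i)" by (simp add: sum_load[OF G])
  also have "\<dots> = sum z V"
  proof (rule sum.cong[OF refl])
    fix i assume "i \<in> V"
    then show "z i * load E y i = z i" using y'eq[of i] z0[of i] by (auto simp: load_y less_le)
  qed
  finally have yval: "(\<Sum>e\<in>E. w e * y e) = sum z V" .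
  have weak: "(\<Sum>e\<in>E. w e * x e) \<le> sum z V" if x: "lp_feasible V E x" for x
  proof -
    have "(\<Sum>e\<in>E. w e * x e) \<le> (\<Sum>e\<in>E. x e * sum z e)"
    proof (rule sum_mono)
      fix e assume "e \<in> E"
      then show "w e * x e \<le> x e * sum z e"
        using x zE[of e] by (auto simp: lp_feasible_def mult.commute[of "w e"] intro!: mult_left_mono)
    qed
    also have "\<dots> = (\<Sum>i\<in>V. z i * load E x i)" by (simp add: sum_load[OF G])
    also have "\<dots> \<le> (\<Sum>i\<in>V. z i)"
      using x z0 by (intro sum_mono) (auto simp: lp_feasible_iff[OF G] intro: mult_left_le)
    finally show ?thesis .
  qed
  have "lp_optimal V E w y" using feas weak yval by (auto simp: lp_optimal_def)
  then have y01: "y e \<in> {0, 1}" if "e \<in> E" for e using tight that by (auto simp: lp_tight_def)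
  define N where "N = {e \<in> E. y e = 1}"
  have yN: "y = restrict (\<lambda>e. of_bool (e \<in> N)) E"
    using y01 by (fastforce simp: N_def y_def restrict_def)
  have N: "is_matching E N" unfolding is_matching_def
  proof (intro conjI ballI impI)
    fix e f assume ef: "e \<in> N" "f \<in> N" "e \<noteq> f"
    show "e \<inter> f = {}"
    proof (rule ccontr)
      assume "e \<inter> f \<noteq> {}"
      then obtain i where i: "i \<in> e" "i \<in> f" by auto
      have "i \<in> V" using i ef G by (auto simp: N_def simple_graph_def)
      have y_nonneg: "0 \<le> y g" if "g \<in> E" for g using y01[OF that] by auto
      have "2 = sum y {e, f}" using ef by (simp add: N_def)
      also have "\<dots> \<le> load E y i" unfolding load_def
      proof (rule sum_mono2)
        show "finite {e \<in> E. i \<in> e}" using fE by simp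
        show "{e, f} \<subseteq> {e \<in> E. i \<in> e}" using ef i by (auto simp: N_def)
      qed (use y_nonneg in auto)
      finally show False using feas \<open>i \<in> V\<close> by (auto simp: lp_feasible_iff[OF G])
    qed
  qed (auto simp: N_def)
  have "max_weight_matching E w N" unfolding max_weight_matching_def
  proof (intro conjI allI impI N)
    fix N' assume N': "is_matching E N'"
    show "sum w N' \<le> sum w N"
      using weak[OF lp_feasible_matching[OF G N']] yval[unfolded yN]
        sum_restrict_matching[OF fE, of N' w] sum_restrict_matching[OF fE, of N w] N N'
      by (simp add: is_matching_def)
  qed
  then have NM: "N = M" by (rule M)
  show "w e = sum z e" if "e \<in> M" for e
    using that y'w[of e] by (auto simp: NM[symmetric] N_def y_def)
  show "\<exists>e\<in>M. i \<in> e" if i: "i \<in> V" "0 < z i" for i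
  proof (rule ccontr)
    assume no: "\<not> (\<exists>e\<in>M. i \<in> e)"
    have "load E y i = 0" unfolding load_def yN using no NM by (intro sum.neutral) auto
    then show False using y'eq[OF i] load_y by simp
  qed
qed


text \<open>Dropping an edge of weight 0 would give a second maximum-weight matching. Positivity
  yields the strict comparison at a root edge in \<open>M\<close>.\<close>

lemma max_weight_matching_edge_pos:
  assumes G: "simple_graph V E" and w: "\<forall>e\<in>E. 0 \<le> w e" and M: "max_weight_matching E w M"
    and unique: "\<forall>N. max_weight_matching E w N \<longrightarrow> N = M" and e: "e \<in> M"
  shows "0 < w e"
proof (rule ccontr)
  assume "\<not> 0 < w e"
  moreover have ME: "M \<subseteq> E" using M by (simp add: max_weight_matching_def is_matching_def)
  ultimately have "w e = 0" using w e by (meson antisym_conv not_less subsetD)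
  moreover have "finite M" using ME simple_graph_finite_edges[OF G] by (rule finite_subset)
  ultimately have "sum w (M - {e}) = sum w M" using e by (simp add: sum_diff1)
  moreover have "is_matching E (M - {e})"
    using M by (auto simp: max_weight_matching_def is_matching_def)
  ultimately have "max_weight_matching E w (M - {e})" using M by (simp add: max_weight_matching_def)
  then have "M - {e} = M" using unique by blast
  then show False using e by blast
qed


section \<open>Computation trees as non-backtracking walks\<close>

text \<open>The edge above \<open>p\<close>. For both endpoints of the root edge this is the root
  edge itself, so non-backtracking becomes a single condition.\<close>

definition pedge :: "'v set \<Rightarrow> 'v list \<Rightarrow> 'v list set" where
  "pedge e p = (if tl p = [] then root_edge e else {p, tl p})"

inductive_set walks :: "'v set set \<Rightarrow> 'v set \<Rightarrow> 'v list set" for E e where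
  root: "u \<in> e \<Longrightarrow> [u] \<in> walks E e"
| step: "q \<in> walks E e \<Longrightarrow> {x, hd q} \<in> E \<Longrightarrow> {x, hd q} \<noteq> hd ` pedge e q \<Longrightarrow> x # q \<in> walks E e"

text \<open>The bound is on the parent, so children have length up to \<open>n\<close>;
  \<open>p \<noteq> []\<close> excludes edges from the empty list to an endpoint of the root
  edge.\<close>

definition walk_edges :: "'v set set \<Rightarrow> 'v set \<Rightarrow> nat \<Rightarrow> 'v list set set" where
  "walk_edges E e n =
     insert (root_edge e) {{p, x # p} | p x. p \<noteq> [] \<and> x # p \<in> walks E e \<and> length p < n}"

lemma hd_image_root_edge [simp]: "hd ` root_edge e = e"
  by (auto simp: root_edge_def image_image)

lemma hd_image_pedge_Cons: "q \<noteq> [] \<Longrightarrow> hd ` pedge e (x # q) = {x, hd q}"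
  by (simp add: pedge_def)

lemma walks_nonempty: "p \<in> walks E e \<Longrightarrow> p \<noteq> []"
  by (induction rule: walks.induct) auto

lemma walks_singleton: "[u] \<in> walks E e \<longleftrightarrow> u \<in> e"
proof
  assume "[u] \<in> walks E e"
  then show "u \<in> e" by (cases rule: walks.cases) (use walks_nonempty in auto)
qed (rule walks.root)

lemma walks_Cons:
  assumes "p \<noteq> []"
  shows "x # p \<in> walks E e \<longleftrightarrow>
    p \<in> walks E e \<and> {x, hd p} \<in> E \<and> {x, hd p} \<noteq> hd ` pedge e p"
  using assms by (auto elim: walks.cases intro: walks.step)

lemma hd_image_pedge_in:
  assumes "e \<in> E" "p \<in> walks E e"
  shows "hd ` pedge e p \<in> E"
  using assms(2)
proof (cases rule: walks.cases)
  case (root u)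
  then show ?thesis using assms(1) by (simp add: pedge_def)
next
  case (step q x)
  then show ?thesis using walks_nonempty[of q] by (simp add: hd_image_pedge_Cons)
qed

lemma in_pedge: "p \<in> walks E e \<Longrightarrow> p \<in> pedge e p"
  by (erule walks.cases) (auto simp: pedge_def root_edge_def dest: walks_nonempty)

lemma hd_in_pedge: "p \<in> walks E e \<Longrightarrow> hd p \<in> hd ` pedge e p"
  using in_pedge by blast

lemma pedgeE:
  assumes "simple_graph V E" "e \<in> E" "p \<in> walks E e"
  obtains q where "pedge e p = {p, q}" "q \<noteq> p"
  using assms(3)
proof (cases rule: walks.cases)
  case (root u)
  obtain v where "e = {u, v}" "u \<noteq> v"
    using root simple_graph_edgeE[OF assms(1,2)] by (metis insertE insert_commute singletonD)
  then show ?thesis using that[of "[v]"] root by (auto simp: pedge_def root_edge_def)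
next
  case (step q x)
  then show ?thesis using that[of q] walks_nonempty[of q] by (auto simp: pedge_def)
qed

text \<open>Needed to recognise leaves: at \<open>length p = n\<close> only the other end of the
  edge above \<open>p\<close> remains.\<close>

lemma neighbors_walk_edges:
  assumes p: "p \<in> walks E e" "length p \<le> n" and q: "pedge e p = {p, q}" "q \<noteq> p"
  shows "neighbors (walk_edges E e n) p = insert q {x # p | x. x # p \<in> walks E e \<and> length p < n}"
proof (intro equalityI subsetI)
  fix j assume "j \<in> neighbors (walk_edges E e n) p"
  then consider (root) "{p, j} = root_edge e"
    | (edge) p' x where "{p, j} = {p', x # p'}" "p' \<noteq> []" "x # p' \<in> walks E e" "length p' < n"
    by (auto simp: neighbors_def walk_edges_def)
  then show "j \<in> insert q {x # p | x. x # p \<in> walks E e \<and> length p < n}"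
  proof cases
    case root
    then have "p \<in> root_edge e" by auto
    then have "tl p = []" by (auto simp: root_edge_def)
    then show ?thesis using root q by (auto simp: pedge_def doubleton_eq_iff)
  next
    case edge
    then show ?thesis using q by (auto simp: doubleton_eq_iff pedge_def)
  qed
next
  fix j assume "j \<in> insert q {x # p | x. x # p \<in> walks E e \<and> length p < n}"
  then consider "j = q" | x where "j = x # p" "x # p \<in> walks E e" "length p < n" by auto
  then show "j \<in> neighbors (walk_edges E e n) p"
  proof cases
    case 1
    show ?thesis
    proof (cases "tl p = []")
      case True
      then show ?thesis using q 1 by (simp add: pedge_def neighbors_def walk_edges_def)
    next
      case False
      then have "q = tl p" using q by (simp add: pedge_def doubleton_eq_iff)
      moreover obtain x where "p = x # tl p" using walks_nonempty[OF p(1)] by (cases p) auto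
      ultimately have "{p, q} = {q, x # q}" "q \<noteq> []" "x # q \<in> walks E e" "length q < n"
        using False p by (auto simp: diff_less_mono Suc_le_eq[symmetric] simp del: length_tl)
          (metis Suc_le_eq length_Cons)
      then show ?thesis using 1 by (auto simp: neighbors_def walk_edges_def)
    qed
  next
    case 2
    then show ?thesis using walks_nonempty[OF p(1)] by (auto simp: neighbors_def walk_edges_def)
  qed
qed

text \<open>All nodes of maximal length are leaves, and their new children are exactly the one-step
  non-backtracking extensions.\<close>

lemma full_tree_eq_walks:
  assumes G: "simple_graph V E" and e: "e \<in> E"
  shows "full_tree E e (Suc n) = ({p \<in> walks E e. length p \<le> Suc n}, walk_edges E e (Suc n))"
proof (induction n)
  case 0
  have "p \<in> walks E e \<and> length p \<le> Suc 0 \<longleftrightarrow> p \<in> root_edge e" for p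
    using walks_nonempty[of p E e]
    by (cases p) (auto simp: root_edge_def walks_singleton)
  then show ?case by (auto simp: full_tree_def walk_edges_def)
next
  case (Suc n)
  define T where "T = full_tree E e (Suc n)"
  have T: "nodes T = {p \<in> walks E e. length p \<le> Suc n}" "edges T = walk_edges E e (Suc n)"
    using Suc by (simp_all add: T_def)
  have new: "leaf T p \<and> c \<in> new_children E T p \<longleftrightarrow>
    (\<exists>x. c = x # p \<and> p \<noteq> [] \<and> c \<in> walks E e \<and> length p = Suc n)" for p c
  proof (cases "p \<in> walks E e \<and> length p \<le> Suc n")
    case False
    then show ?thesis by (auto simp: leaf_def T walks_Cons)
  next
    case True
    then have p: "p \<noteq> []" using walks_nonempty by auto
    obtain q where q: "pedge e p = {p, q}" "q \<noteq> p" using pedgeE[OF G e] True by metis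
    have nb: "neighbors (edges T) p = insert q {x # p | x. x # p \<in> walks E e \<and> length p < Suc n}"
      unfolding T using True q by (intro neighbors_walk_edges) auto
    have child: "x # p \<in> walks E e \<longleftrightarrow> x \<in> neighbors E (hd p) \<and> x \<noteq> hd q" for x
      using True p q by (auto simp: walks_Cons neighbors_def insert_commute doubleton_eq_iff)
    show ?thesis
    proof (cases "length p = Suc n")
      case len: True
      then have "leaf T p" using True by (simp add: leaf_def nb) (simp add: T)
      then show ?thesis using len p child by (auto simp: new_children_def nb)
    next
      case False
      \<comment> \<open>A shorter node may be a leaf too, if its vertex is a dead end of the graph,
        but all its possible children are already present.\<close>
      then have "new_children E T p = {}"
        using True child by (fastforce simp: new_children_def nb)
      then show ?thesis using False by simp
    qed
  qed
  have "full_tree E e (Suc (Suc n)) = grow E T" by (simp add: full_tree_def T_def)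
  also have "\<dots> = ({p \<in> walks E e. length p \<le> Suc (Suc n)}, walk_edges E e (Suc (Suc n)))"
  proof -
    have "nodes T \<union> {c. \<exists>p. leaf T p \<and> c \<in> new_children E T p} =
      {p \<in> walks E e. length p \<le> Suc (Suc n)}" (is "?L = ?R")
    proof (intro equalityI subsetI)
      fix c assume "c \<in> ?R"
      then show "c \<in> ?L" unfolding new T
        by (cases c) (auto simp: le_Suc_eq)
    qed (auto simp: new T)
    moreover have "edges T \<union> {{p, c} | p c. leaf T p \<and> c \<in> new_children E T p} =
      walk_edges E e (Suc (Suc n))"
      unfolding new T walk_edges_def by (auto simp: less_Suc_eq)
    ultimately show ?thesis by (simp add: grow_def)
  qed
  finally show ?case .
qed

lemma finite_walk_edges:
  assumes G: "simple_graph V E" and e: "e \<in> E"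
  shows "finite (walk_edges E e n)"
proof -
  have fV: "finite V" using G by (simp add: simple_graph_def)
  have lists: "p \<in> walks E e \<Longrightarrow> set p \<subseteq> V" for p
    by (induction rule: walks.induct) (use G e in \<open>auto simp: simple_graph_def\<close>)
  have "{{p, x # p} | p x. p \<noteq> [] \<and> x # p \<in> walks E e \<and> length p < n}
    \<subseteq> (\<lambda>c. {tl c, c}) ` {c. set c \<subseteq> V \<and> length c \<le> n}"
  proof clarify
    fix p x assume "x # p \<in> walks E e" "length p < n"
    then show "{p, x # p} \<in> (\<lambda>c. {tl c, c}) ` {c. set c \<subseteq> V \<and> length c \<le> n}"
      using lists[of "x # p"] by (intro image_eqI[of _ _ "x # p"]) auto
  qed
  moreover have "finite {c. set c \<subseteq> V \<and> length c \<le> n}" by (rule finite_lists_length_le[OF fV])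
  ultimately show ?thesis
    unfolding walk_edges_def by (meson finite_insert finite_imageI finite_subset)
qed


section \<open>Exchange below a node\<close>

text \<open>Lists grow at the front, so descendants of \<open>p\<close> are the lists with suffix
  \<open>p\<close>. Edges from \<open>p\<close> to its children belong to \<open>below p\<close>,
  the edge above \<open>p\<close> does not.\<close>

definition below :: "'v list \<Rightarrow> 'v list set set" where
  "below p = {d. \<forall>q\<in>d. suffix p q}"

lemma below_Cons_subset: "below (x # p) \<subseteq> below p"
  unfolding below_def using suffix_ConsD by fast

lemma child_edge_below: "{p, x # p} \<in> below p"
  by (auto simp: below_def suffix_Cons)

lemma not_in_below_Cons: "d \<in> below (x # p) \<Longrightarrow> p \<notin> d"
  by (auto simp: below_def suffix_def)

lemma matching_unique: "is_matching E N \<Longrightarrow> d \<in> N \<Longrightarrow> f \<in> N \<Longrightarrow> p \<in> d \<Longrightarrow> p \<in> f \<Longrightarrow> d = f"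
  unfolding is_matching_def by blast

lemma is_matching_subset: "is_matching E N \<Longrightarrow> N' \<subseteq> N \<Longrightarrow> is_matching E N'"
  unfolding is_matching_def by (meson subset_iff)

lemma is_matching_insert:
  assumes "is_matching E N" "d \<in> E" "\<And>p. p \<in> d \<Longrightarrow> p \<notin> \<Union> N"
  shows "is_matching E (insert d N)"
proof -
  have "d \<inter> f = {}" if "f \<in> N" for f using assms(3) that by blast
  then show ?thesis using assms(1,2) by (simp add: is_matching_def Int_commute)
qed

text \<open>\<open>TE\<close> lies between the full trees of depths \<open>k\<close> and
  \<open>m\<close>, which covers asynchronous updates; \<open>C\<close> bounds the weights.\<close>

locale slack_tree =
  fixes V :: "'v set" and E :: "'v set set" and w :: "'v set \<Rightarrow> real" and M :: "'v set set"
    and z :: "'v \<Rightarrow> real" and \<epsilon> C :: real and e :: "'v set" and TE :: "'v list set set"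
    and k m :: nat
  assumes G: "simple_graph V E" and e: "e \<in> E"
    and M: "is_matching E M"
    and tight: "\<And>d. d \<in> M \<Longrightarrow> w d = sum z d"
    and slack: "\<And>d. d \<in> E \<Longrightarrow> d \<notin> M \<Longrightarrow> w d \<le> sum z d - \<epsilon>"
    and saturated: "\<And>i. i \<in> V \<Longrightarrow> 0 < z i \<Longrightarrow> \<exists>d\<in>M. i \<in> d"
    and z_nonneg: "\<And>i. i \<in> V \<Longrightarrow> 0 \<le> z i"
    and w_le: "\<And>d. d \<in> E \<Longrightarrow> w d \<le> C" and C_nonneg: "0 \<le> C"
    and eps_pos: "0 < \<epsilon>"
    and tree_sub: "TE \<subseteq> walk_edges E e m" and tree_full: "walk_edges E e k \<subseteq> TE"
begin

lemma finite_tree: "finite TE"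
  using tree_sub finite_walk_edges[OF G e] finite_subset by blast

lemma finite_matching: "is_matching TE N \<Longrightarrow> finite N"
  using finite_tree by (auto simp: is_matching_def intro: finite_subset)

lemma edge_at:
  assumes "d \<in> TE" "p \<in> d" "p \<in> walks E e"
  shows "d = pedge e p \<or> (\<exists>x. d = {p, x # p} \<and> x # p \<in> walks E e)"
proof -
  consider "d = root_edge e" | q x where "d = {q, x # q}" "q \<noteq> []" "x # q \<in> walks E e"
    using assms(1) tree_sub by (auto simp: walk_edges_def)
  then show ?thesis using assms(2) by cases (auto simp: pedge_def root_edge_def)
qed

lemma pedge_not_below:
  assumes "p \<in> walks E e" shows "pedge e p \<notin> below p"
  using assms
proof (cases rule: walks.cases)
  case (root u)
  obtain v where "e = {u, v}" "u \<noteq> v"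
    using root simple_graph_edgeE[OF G e] by (metis insertE insert_commute singletonD)
  then show ?thesis using root by (auto simp: pedge_def root_edge_def below_def suffix_Cons)
next
  case (step q x)
  then show ?thesis using walks_nonempty[of q] by (auto simp: pedge_def below_def suffix_def)
qed

lemma hd_in_V:
  assumes "p \<in> walks E e" shows "hd p \<in> V"
proof -
  have "hd ` pedge e p \<subseteq> V"
    using hd_image_pedge_in[OF e assms] G by (simp add: simple_graph_def)
  then show ?thesis using hd_in_pedge[OF assms] by blast
qed

lemma sum_z:
  assumes "{i, j} \<in> E" shows "sum z {i, j} = z i + z j"
  using simple_graph_no_loop[OF G assms] by simp

text \<open>A vertex with positive \<open>z\<close> lies on a tight matching edge, whose weight
  bounds \<open>z\<close>. This starts the induction.\<close>

lemma z_le_C: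
  assumes i: "i \<in> V" shows "z i \<le> C"
proof (cases "0 < z i")
  case True
  then obtain d where d: "d \<in> M" "i \<in> d" using saturated i by blast
  then have dE: "d \<in> E" using M by (auto simp: is_matching_def)
  then have "finite d" "d \<subseteq> V" using G card_ge_0_finite[of d] by (auto simp: simple_graph_def)
  then have "z i \<le> sum z d" using d z_nonneg by (intro member_le_sum) auto
  then show ?thesis using tight[OF d(1)] w_le[OF dE] by simp
qed (use C_nonneg in simp)

text \<open>
  Let \<open>D\<close> be the excess of the heaviest matching below \<open>p\<close> over the heaviest one that leaves \<open>p\<close>
  uncovered, and \<open>n\<close> the number of levels below \<open>p\<close> on which the tree is full. \<open>gain n\<close> bounds
  \<open>D\<close> from below when the edge above \<open>p\<close> is not a copy of an edge of \<open>M\<close>, and \<open>loss n\<close> bounds it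
  from above when it is; in both cases \<open>z (hd p)\<close> is the value of \<open>D\<close> on the infinite tree.
\<close>

definition gain :: "nat \<Rightarrow> bool" where
  "gain n \<longleftrightarrow> (\<forall>p N. p \<in> walks E e \<longrightarrow> k - length p = n \<longrightarrow> hd ` pedge e p \<notin> M \<longrightarrow>
     is_matching TE N \<longrightarrow> p \<notin> \<Union> N \<longrightarrow>
     (\<exists>N'. is_matching TE N' \<and> N' - below p = N - below p \<and>
       tree_weight w N' \<ge> tree_weight w N + z (hd p) - max 0 (C - \<epsilon> * real n / 2)))"

definition loss :: "nat \<Rightarrow> bool" where
  "loss n \<longleftrightarrow> (\<forall>p N. p \<in> walks E e \<longrightarrow> k - length p = n \<longrightarrow> hd ` pedge e p \<in> M \<longrightarrow>
     is_matching TE N \<longrightarrow>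
     (\<exists>N'. is_matching TE N' \<and> N' - below p = N - below p \<and> (\<forall>d\<in>N' \<inter> below p. p \<notin> d) \<and>
       tree_weight w N' \<ge> tree_weight w N - z (hd p)
         - max (- z (hd p)) (max (- \<epsilon>) (C - \<epsilon> * (real n + 1) / 2))))"

text \<open>Subtraction truncates, so level 0 comprises every node of length at least
  \<open>k\<close>. Leaving \<open>N\<close> unchanged is within the error \<open>C\<close>.\<close>

lemma gain_0: "gain 0"
  unfolding gain_def
proof (intro allI impI)
  fix p N assume p: "p \<in> walks E e" "is_matching TE N"
  have "z (hd p) \<le> max 0 C" using z_le_C[OF hd_in_V[OF p(1)]] by simp
  then show "\<exists>N'. is_matching TE N' \<and> N' - below p = N - below p \<and>
       tree_weight w N' \<ge> tree_weight w N + z (hd p) - max 0 (C - \<epsilon> * real 0 / 2)"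
    using p(2) by (intro exI[of _ N]) auto
qed

text \<open>If \<open>z (hd p)\<close> is positive, some edge of \<open>M\<close> leads from
  \<open>p\<close> to a child \<open>c\<close>. Freeing \<open>c\<close> costs its \<open>z\<close>
  value up to the error, and adding the tight edge \<open>{p, c}\<close> returns both
  \<open>z\<close> values.\<close>

lemma gain_Suc:
  assumes "loss n" shows "gain (Suc n)"
  unfolding gain_def
proof (intro allI impI)
  fix p N assume p: "p \<in> walks E e" and k: "k - length p = Suc n"
    and pM: "hd ` pedge e p \<notin> M" and N: "is_matching TE N" and pN: "p \<notin> \<Union> N"
  show "\<exists>N'. is_matching TE N' \<and> N' - below p = N - below p \<and>
       tree_weight w N' \<ge> tree_weight w N + z (hd p) - max 0 (C - \<epsilon> * real (Suc n) / 2)"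
  proof (cases "0 < z (hd p)")
    case False
    then have "z (hd p) \<le> max 0 (C - \<epsilon> * real (Suc n) / 2)" by (meson max.coboundedI1 not_less)
    then show ?thesis using N by (intro exI[of _ N]) simp
  next
    case True
    then obtain f where f: "f \<in> M" "hd p \<in> f" using saturated hd_in_V[OF p] by blast
    then have fE: "f \<in> E" using M by (auto simp: is_matching_def)
    obtain x where x: "f = {x, hd p}"
      using f(2) simple_graph_edgeE[OF G fE] by (metis insertE insert_commute singletonD)
    have p0: "p \<noteq> []" using walks_nonempty[OF p] .
    define c where "c = x # p"
    \<comment> \<open>No backtracking: \<open>f\<close> is in \<open>M\<close>, the edge copied
      above \<open>p\<close> is not.\<close>
    have c: "c \<in> walks E e" unfolding c_def walks_Cons[OF p0] using p fE f(1) x pM by auto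
    have cT: "{p, c} \<in> TE"
    proof -
      have "length p < k" using k by simp
      then have "{p, c} \<in> walk_edges E e k" using c p0 unfolding walk_edges_def c_def by blast
      then show ?thesis using tree_full by blast
    qed
    have cM: "hd ` pedge e c \<in> M" using f(1) x p0 by (simp add: c_def hd_image_pedge_Cons)
    have "k - length c = n" using k by (simp add: c_def)
    then obtain N1 where N1: "is_matching TE N1" "N1 - below c = N - below c"
      "\<forall>d\<in>N1 \<inter> below c. c \<notin> d"
      "tree_weight w N1 \<ge> tree_weight w N - z x - max (- z x) (max (- \<epsilon>) (C - \<epsilon> * (real n + 1) / 2))"
      using assms c cM N unfolding loss_def by (metis c_def list.sel(1))
    have pN1: "p \<notin> \<Union> N1"
      using N1(2) pN not_in_below_Cons[of _ x p] by (auto simp: c_def)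
    \<comment> \<open>Edges of \<open>N1\<close> below \<open>c\<close> avoid \<open>c\<close>, and
      the edge above \<open>c\<close> contains \<open>p\<close>, which is still free.\<close>
    have cN1: "c \<notin> \<Union> N1"
    proof
      assume "c \<in> \<Union> N1"
      then obtain d where d: "d \<in> N1" "c \<in> d" by auto
      then have dN: "d \<notin> below c" using N1(3) by auto
      have "d \<in> TE" using d N1(1) by (auto simp: is_matching_def)
      then have "d = pedge e c"
        using edge_at[of d c] c d(2) dN child_edge_below[of c] by metis
      then have "p \<in> d" using p0 by (simp add: pedge_def c_def)
      then show False using pN1 d by auto
    qed
    have "is_matching TE (insert {p, c} N1)"
      using N1(1) cT pN1 cN1 by (intro is_matching_insert) auto
    moreover have "insert {p, c} N1 - below p = N - below p"
      using N1(2) below_Cons_subset[of x p] child_edge_below[of p x] by (auto simp: c_def)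
    moreover have "tree_weight w (insert {p, c} N1) = tree_weight w N1 + z x + z (hd p)"
    proof -
      have "{p, c} \<notin> N1" using pN1 by auto
      moreover have "hd ` {p, c} = f" using x by (auto simp: c_def)
      ultimately show ?thesis
        using finite_matching[OF N1(1)] tight[OF f(1)] sum_z[of x "hd p"] fE x
        by (simp add: tree_weight_def)
    qed
    moreover have "max (- z x) (max (- \<epsilon>) (C - \<epsilon> * (real n + 1) / 2)) \<le> max 0 (C - \<epsilon> * real (Suc n) / 2)"
    proof -
      have "x \<in> V" using fE x G by (auto simp: simple_graph_def)
      then show ?thesis using z_nonneg eps_pos by (auto simp: add.commute intro: le_max_iff_disj[THEN iffD2])
    qed
    ultimately show ?thesis using N1(4) by (intro exI[of _ "insert {p, c} N1"]) auto
  qed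
qed

text \<open>An edge from \<open>p\<close> down to a child is outside \<open>M\<close>, since
  \<open>M\<close> already covers \<open>hd p\<close> by the edge above. Removing it costs at most
  the two \<open>z\<close> values minus \<open>\<epsilon>\<close>, and the gain at the child returns
  one of them.\<close>

lemma loss_if_gain:
  assumes "gain (n - 1)" shows "loss n"
  unfolding loss_def
proof (intro allI impI)
  fix p N assume p: "p \<in> walks E e" and k: "k - length p = n"
    and pM: "hd ` pedge e p \<in> M" and N: "is_matching TE N"
  \<comment> \<open>The three terms answer to \<open>p\<close> being free already, to a vanished
    error at the child, and to a positive one.\<close>
  let ?b = "max (- z (hd p)) (max (- \<epsilon>) (C - \<epsilon> * (real n + 1) / 2))"
  show "\<exists>N'. is_matching TE N' \<and> N' - below p = N - below p \<and> (\<forall>d\<in>N' \<inter> below p. p \<notin> d) \<and>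
       tree_weight w N' \<ge> tree_weight w N - z (hd p) - ?b"
  proof (cases "\<forall>d\<in>N \<inter> below p. p \<notin> d")
    case True
    moreover have "- z (hd p) \<le> ?b" by (rule max.cobounded1)
    ultimately show ?thesis using N by (intro exI[of _ N]) simp
  next
    case False
    then obtain d where d: "d \<in> N" "d \<in> below p" "p \<in> d" by auto
    have dT: "d \<in> TE" using d N by (auto simp: is_matching_def)
    obtain x where x: "d = {p, x # p}" "x # p \<in> walks E e"
      using edge_at[OF dT d(3) p] pedge_not_below[OF p] d(2) by auto
    have p0: "p \<noteq> []" using walks_nonempty[OF p] .
    define c where "c = x # p"
    have xE: "{x, hd p} \<in> E" and xp: "{x, hd p} \<noteq> hd ` pedge e p"
      using x(2) by (auto simp: walks_Cons[OF p0])
    have xM: "{x, hd p} \<notin> M"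
      using matching_unique[OF M _ pM, of "{x, hd p}" "hd p"] xp hd_in_pedge[OF p] by auto
    have cM: "hd ` pedge e c \<notin> M" using xM p0 by (simp add: c_def hd_image_pedge_Cons)
    define N0 where "N0 = N - {d}"
    have N0: "is_matching TE N0" using N by (rule is_matching_subset) (auto simp: N0_def)
    have cN0: "c \<notin> \<Union> N0" and pN0: "p \<notin> \<Union> N0"
      using matching_unique[OF N d(1)] d(3) x(1) by (auto simp: N0_def c_def)
    have "k - length c = n - 1" using k by (simp add: c_def)
    then obtain N1 where N1: "is_matching TE N1" "N1 - below c = N0 - below c"
      "tree_weight w N1 \<ge> tree_weight w N0 + z x - max 0 (C - \<epsilon> * real (n - 1) / 2)"
      using assms x(2) cM N0 cN0 unfolding gain_def by (metis c_def list.sel(1))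
    have "N1 - below p = N - below p"
      using N1(2) below_Cons_subset[of x p] d(2) by (auto simp: c_def N0_def)
    moreover have "\<forall>g\<in>N1 \<inter> below p. p \<notin> g"
      using N1(2) pN0 not_in_below_Cons[of _ x p] by (auto simp: c_def)
    moreover have "tree_weight w N0 = tree_weight w N - w {x, hd p}"
    proof -
      have "hd ` d = {x, hd p}" using x(1) by auto
      then show ?thesis using finite_matching[OF N] d(1) by (simp add: tree_weight_def N0_def sum_diff1)
    qed
    moreover have "w {x, hd p} \<le> z x + z (hd p) - \<epsilon>"
      using slack[OF xE xM] sum_z[OF xE] by simp
    moreover have "max 0 (C - \<epsilon> * real (n - 1) / 2) - \<epsilon> \<le> ?b"
    proof (cases n)
      case 0
      then show ?thesis using eps_pos C_nonneg by (auto simp: max_def)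
    next
      case (Suc l)
      then show ?thesis using eps_pos by (auto simp: max_def field_simps)
    qed
    ultimately show ?thesis using N1(1,3) by (intro exI[of _ N1]) auto
  qed
qed

lemma gain_loss: "gain n \<and> loss n"
proof (induction n)
  case 0
  \<comment> \<open>Here \<open>0 - 1 = 0\<close>: children of a level 0 node are again at level
    0.\<close>
  then show ?case using gain_0 loss_if_gain[of 0] by simp
next
  case (Suc n)
  then show ?case using gain_Suc[of n] loss_if_gain[of "Suc n"] by simp
qed

section \<open>Comparison at the root edge\<close>

context
  fixes u v
  assumes k: "2 * C < \<epsilon> * real k" "1 \<le> k" and uv: "e = {u, v}"
begin

lemma u_neq_v: "u \<noteq> v"
  using simple_graph_no_loop[OF G] e uv by auto

lemma root_walks: "[u] \<in> walks E e" "[v] \<in> walks E e"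
  by (auto simp: walks_singleton uv)

lemma pedge_root [simp]: "pedge e [x] = root_edge e"
  by (simp add: pedge_def)

lemma root_edge_uv: "root_edge e = {[u], [v]}"
  by (simp add: root_edge_def uv)

lemma root_in_tree: "root_edge e \<in> TE"
  using tree_full by (auto simp: walk_edges_def)

lemma in_below_singleton: "d \<in> below [x] \<Longrightarrow> [y] \<in> d \<Longrightarrow> x = y"
  by (auto simp: below_def suffix_Cons)

lemma root_not_below: "root_edge e \<notin> below [u]" "root_edge e \<notin> below [v]"
  using in_below_singleton[of "root_edge e" u v] in_below_singleton[of "root_edge e" v u] u_neq_v
  by (auto simp: root_edge_uv)

text \<open>Freeing both endpoints and inserting the root edge changes the weight by minus the two
  errors. Both are nonpositive, and one is negative because \<open>z u + z v = w e\<close> is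
  positive.\<close>

lemma improve_in_matching:
  assumes eM: "e \<in> M" and we: "0 < w e" and N: "is_matching TE N" and r: "root_edge e \<notin> N"
  shows "\<exists>N'. is_matching TE N' \<and> root_edge e \<in> N' \<and> tree_weight w N < tree_weight w N'"
proof -
  have loss: "loss (k - 1)" using gain_loss by simp
  have k1: "real (k - 1) + 1 = real k" using k(2) by simp
  obtain N1 where N1: "is_matching TE N1" "N1 - below [u] = N - below [u]"
    "\<forall>d\<in>N1 \<inter> below [u]. [u] \<notin> d"
    "tree_weight w N1 \<ge> tree_weight w N - z u - max (- z u) (max (- \<epsilon>) (C - \<epsilon> * real k / 2))"
    using loss[unfolded loss_def, rule_format, of "[u]" N] root_walks N eM
    unfolding k1 by auto
  obtain N2 where N2: "is_matching TE N2" "N2 - below [v] = N1 - below [v]"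
    "\<forall>d\<in>N2 \<inter> below [v]. [v] \<notin> d"
    "tree_weight w N2 \<ge> tree_weight w N1 - z v - max (- z v) (max (- \<epsilon>) (C - \<epsilon> * real k / 2))"
    using loss[unfolded loss_def, rule_format, of "[v]" N1] root_walks N1(1) eM
    unfolding k1 by auto
  have r1: "root_edge e \<notin> N1" using r N1(2) root_not_below by auto
  then have r2: "root_edge e \<notin> N2" using N2(2) root_not_below by auto
  have edge_below: "d \<in> below [x]"
    if "[x] \<in> d" "d \<in> TE" "d \<noteq> root_edge e" "x \<in> e" for d x
    using edge_at[of d "[x]"] that child_edge_below[of "[x]"] by (auto simp: walks_singleton)
  have vN2: "[v] \<notin> \<Union> N2"
  proof
    assume "[v] \<in> \<Union> N2"
    then obtain d where d: "d \<in> N2" "[v] \<in> d" by auto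
    then have "d \<in> below [v]"
      using edge_below[of v d] r2 N2(1) by (auto simp: is_matching_def uv)
    then show False using d N2(3) by auto
  qed
  have uN2: "[u] \<notin> \<Union> N2"
  proof
    assume "[u] \<in> \<Union> N2"
    then obtain d where d: "d \<in> N2" "[u] \<in> d" by auto
    then have "d \<notin> below [v]" using in_below_singleton[of d v u] u_neq_v by auto
    then have d1: "d \<in> N1" using d N2(2) by auto
    then have "d \<in> below [u]"
      using edge_below[of u d] d r1 N1(1) by (auto simp: is_matching_def uv)
    then show False using d d1 N1(3) by auto
  qed
  have "is_matching TE (insert (root_edge e) N2)"
    using N2(1) root_in_tree uN2 vN2 by (intro is_matching_insert) (auto simp: root_edge_uv)
  moreover have "tree_weight w (insert (root_edge e) N2) = tree_weight w N2 + w e"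
    using r2 finite_matching[OF N2(1)] by (simp add: tree_weight_def)
  moreover have "w e = z u + z v" using tight[OF eM] sum_z[of u v] e uv by simp
  moreover have "C - \<epsilon> * real k / 2 < 0" using k(1) by simp
  moreover have "0 \<le> z u" "0 \<le> z v"
    using z_nonneg hd_in_V[OF root_walks(1)] hd_in_V[OF root_walks(2)] by auto
  ultimately show ?thesis using N1(4) N2(4) we eps_pos
    by (intro exI[of _ "insert (root_edge e) N2"]) (auto simp: max_def split: if_splits)
qed

text \<open>Removing the root edge costs at most \<open>z u + z v - \<epsilon>\<close>; the gains at
  the two endpoints return \<open>z u + z v\<close> up to two errors.\<close>

lemma improve_notin_matching:
  assumes eM: "e \<notin> M" and N: "is_matching TE N" and r: "root_edge e \<in> N"
  shows "\<exists>N'. is_matching TE N' \<and> root_edge e \<notin> N' \<and> tree_weight w N < tree_weight w N'"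
proof -
  have gain: "gain (k - 1)" using gain_loss by simp
  define N0 where "N0 = N - {root_edge e}"
  have N0: "is_matching TE N0" using N by (rule is_matching_subset) (auto simp: N0_def)
  have N0w: "tree_weight w N0 = tree_weight w N - w e"
    using finite_matching[OF N] r by (simp add: tree_weight_def N0_def sum_diff1)
  have uN0: "[u] \<notin> \<Union> N0" and vN0: "[v] \<notin> \<Union> N0"
    using matching_unique[OF N r] by (auto simp: N0_def root_edge_uv)
  obtain N1 where N1: "is_matching TE N1" "N1 - below [u] = N0 - below [u]"
    "tree_weight w N1 \<ge> tree_weight w N0 + z u - max 0 (C - \<epsilon> * real (k - 1) / 2)"
    using gain[unfolded gain_def, rule_format, of "[u]" N0] root_walks N0 eM uN0 by auto
  have vN1: "[v] \<notin> \<Union> N1"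
  proof
    assume "[v] \<in> \<Union> N1"
    then obtain d where d: "d \<in> N1" "[v] \<in> d" by auto
    then have "d \<notin> below [u]" using in_below_singleton[of d u v] u_neq_v by auto
    then show False using d N1(2) vN0 by auto
  qed
  obtain N2 where N2: "is_matching TE N2" "N2 - below [v] = N1 - below [v]"
    "tree_weight w N2 \<ge> tree_weight w N1 + z v - max 0 (C - \<epsilon> * real (k - 1) / 2)"
    using gain[unfolded gain_def, rule_format, of "[v]" N1] root_walks N1(1) eM vN1 by auto
  have "root_edge e \<notin> N2"
    using N2(2) N1(2) root_not_below by (auto simp: N0_def)
  moreover have "w e \<le> z u + z v - \<epsilon>" using slack[OF e eM] sum_z[of u v] e uv by simp
  \<comment> \<open>Root endpoints have length 1, leaving \<open>k - 1\<close> levels; this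
    inequality is exactly \<open>2 * C < \<epsilon> * real k\<close>, so the two errors stay below
    \<open>\<epsilon>\<close> in total.\<close>
  moreover have "max 0 (C - \<epsilon> * real (k - 1) / 2) < \<epsilon> / 2"
    using k eps_pos by (simp add: of_nat_diff field_simps max_def)
  ultimately show ?thesis using N1(3) N2(1,3) N0w by (intro exI[of _ N2]) auto
qed

end

end

text \<open>The maximum over a finite nonempty set is attained; improving a maximiser
  suffices.\<close>

lemma max_root_weight_less:
  assumes fin: "finite (edges T)" and root: "root_edge e \<in> edges T" and x: "x = 0 \<or> x = 1"
    and improve: "\<And>N. is_matching (edges T) N \<Longrightarrow> of_bool (root_edge e \<in> N) = x \<Longrightarrow>
      \<exists>N'. is_matching (edges T) N' \<and> of_bool (root_edge e \<in> N') = y \<and>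
        tree_weight w N < tree_weight w N'"
  shows "max_root_weight w e T x < max_root_weight w e T y"
proof -
  define S where "S a = {tree_weight w N | N. is_matching (edges T) N \<and> of_bool (root_edge e \<in> N) = a}" for a :: nat
  have finS: "finite (S a)" for a
  proof -
    have "S a \<subseteq> tree_weight w ` Pow (edges T)" by (auto simp: S_def is_matching_def)
    then show ?thesis using fin finite_subset by blast
  qed
  have "\<exists>N. is_matching (edges T) N \<and> of_bool (root_edge e \<in> N) = x"
    using x
  proof
    assume "x = 0"
    then show ?thesis by (intro exI[of _ "{}"]) (auto simp: is_matching_def)
  next
    assume "x = 1"
    then show ?thesis using root by (intro exI[of _ "{root_edge e}"]) (auto simp: is_matching_def)
  qed
  then have "S x \<noteq> {}" by (auto simp: S_def)
  then have "Max (S x) \<in> S x" using finS by simp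
  then obtain N where N: "Max (S x) = tree_weight w N" "is_matching (edges T) N"
    "of_bool (root_edge e \<in> N) = x"
    by (auto simp: S_def)
  obtain N' where N': "is_matching (edges T) N'" "of_bool (root_edge e \<in> N') = y"
    "tree_weight w N < tree_weight w N'" using improve N(2,3) by blast
  then have "tree_weight w N' \<in> S y" unfolding S_def by blast
  then have "tree_weight w N < Max (S y)"
    using Max_ge[OF finS, of _ y] N'(3) by fastforce
  then show ?thesis using N(1) by (simp add: max_root_weight_def S_def)
qed

text \<open>The depth \<open>d\<close> lies strictly above the threshold, since beliefs can tie at
  the threshold itself.\<close>

theorem theorem1:
  fixes V :: "'v set" and E :: "'v set set" and w :: "'v set \<Rightarrow> real"
    and M :: "'v set set" and z :: "'v \<Rightarrow> real" and \<epsilon> d :: real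
    and T :: "'v set \<Rightarrow> nat \<Rightarrow> 'v ctree" and e :: "'v set" and t :: nat
  assumes "simple_graph V E"
    and "\<forall>e\<in>E. 0 \<le> w e"
    and "max_weight_matching E w M"
    and "\<forall>N. max_weight_matching E w N \<longrightarrow> N = M"
    and "\<exists>!x. lp_optimal V E w x"
    and "lp_tight V E w"
    and "dual_optimal V E w z"
    and "0 < \<epsilon>"
    and "\<forall>i j. {i, j} \<in> E - M \<longrightarrow> w {i, j} \<le> z i + z j - \<epsilon>"
    and "computation_trees E T"
    and "e \<in> E"
    and "1 \<le> t"
    and "2 * w_max E w / \<epsilon> < d"
    and "full_up_to_depth E e (T e t) d"
  shows "(e \<in> M \<longrightarrow> belief w e (T e t) 1 > belief w e (T e t) 0) \<and>
         (e \<notin> M \<longrightarrow> belief w e (T e t) 1 < belief w e (T e t) 0)"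
proof -
  note G = assms(1) and e = assms(11)
  have fE: "finite E" by (rule simple_graph_finite_edges[OF G])
  obtain k where k: "1 \<le> k" "d \<le> real k" "contained (full_tree E e k) (T e t)"
    using assms(14) by (auto simp: full_up_to_depth_def)
  have sub: "rooted_subtree e (T e t) (full_tree E e t)"
    using assms(10-12) by (auto simp: computation_trees_def)
  have full: "edges (full_tree E e n) = walk_edges E e n" if "1 \<le> n" for n
    using full_tree_eq_walks[OF G e, of "n - 1"] that by simp
  interpret slack_tree V E w M z \<epsilon> "w_max E w" e "edges (T e t)" k t
  proof
    show "is_matching E M" using assms(3) by (simp add: max_weight_matching_def)
    show "w f \<le> sum z f - \<epsilon>" if f: "f \<in> E" "f \<notin> M" for f
    proof -
      obtain i j where "f = {i, j}" "i \<noteq> j" using simple_graph_edgeE[OF G f(1)] by metis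
      then show ?thesis using assms(9) f by simp
    qed
    show "0 \<le> z i" if "i \<in> V" for i
      using that assms(7) by (simp add: dual_optimal_def dual_feasible_def)
    show w_le: "w f \<le> w_max E w" if "f \<in> E" for f using that fE by (simp add: w_max_def)
    show "0 \<le> w_max E w" using w_le[OF e] assms(2) e by force
    show "edges (T e t) \<subseteq> walk_edges E e t"
      using sub full[OF assms(12)] by (simp add: rooted_subtree_def contained_def)
    show "walk_edges E e k \<subseteq> edges (T e t)"
      using k full by (simp add: contained_def)
  qed (use G e assms(8) tight_complementary_slackness[OF G _ assms(6,7), of M] assms(4) in auto)
  obtain u v where uv: "e = {u, v}" using simple_graph_edgeE[OF G e] by metis
  have "2 * w_max E w / \<epsilon> < real k" using assms(13) k(2) by simp
  then have k': "2 * w_max E w < \<epsilon> * real k" using assms(8) by (simp add: field_simps)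
  note root = root_in_tree[OF k' k(1) uv]
  show ?thesis unfolding belief_less_iff
  proof (intro conjI impI)
    assume eM: "e \<in> M"
    then have "0 < w e" using max_weight_matching_edge_pos[OF G assms(2-4)] by blast
    then show "max_root_weight w e (T e t) 0 < max_root_weight w e (T e t) 1"
      using improve_in_matching[OF k' k(1) uv eM] finite_tree root
      by (intro max_root_weight_less) auto
  next
    assume "e \<notin> M"
    then show "max_root_weight w e (T e t) 1 < max_root_weight w e (T e t) 0"
      using improve_notin_matching[OF k' k(1) uv] finite_tree root
      by (intro max_root_weight_less) (auto simp: of_bool_def split: if_splits)
  qed
qed

end
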